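(* Let $N=\{u_1,\dots,u_n\}$ be a finite ground set whose elements arrive in a stream in the order $u_1,\dots,u_n$, let $f:2^N\to\mathbb{R}_{\ge 0}$ be a non-negative (not necessarily monotone) submodular function accessed through a value oracle, let $k\ge 1$ be an integer, let $\epsilon>0$, and let $\mathrm{OPT}=\max\{f(S): S\subseteq N,\ |S|\le k\}$. Then the algorithm $\mathcal{A}_3$ described in the context (with the unconstrained subroutine being a deterministic $1/2$-approximation algorithm for unconstrained non-negative submodular maximization) satisfies: (i) it outputs a set $S$ with $|S|\le k$ and $f(S)\ge (\frac16-\epsilon)\mathrm{OPT}$; (ii) it makes 1 pass over the data set, stores at most $O(\frac{k\log k}{\epsilon})$ elements, and has $O(\frac{\log k}{\epsilon})$ query complexity per element.
   Context: Notation: $f(u\mid T)=f(T\cup\{u\})-f(T)$. Submodularity: $f(S)+f(T)\ge f(S\cup T)+f(S\cap T)$ for all $S,T\subseteq N$. Unconstrained subroutine: $\mathrm{Unconstrained}(A)$ is a deterministic algorithm that, given $A\subseteq N$, returns a set $T\subseteq A$ with $f(T)\ge \frac12\max_{T'\subseteq A} f(T')$. Algorithm $\mathcal{A}_3$: for every $v\in\{(1+\epsilon)^i: i\in\mathbb{Z}\}$ (lazily) maintain sets $S_1^v,S_2^v$, initially empty; set $m=0$. For $j=1,\dots,n$, when $u_j$ arrives: update $m=\max(m,f(\{u_j\}))$; let $Q_j=\{(1+\epsilon)^i: i\in\mathbb{Z},\ m\le (1+\epsilon)^i\le 6km\}$; delete all maintained sets $S_l^v$ with $v\notin Q_j$;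 then for each $v\in Q_j$, with $\tau=v/6$: if $f(u_j\mid S_1^v)\ge \tau/k$ and $|S_1^v|<k$, add $u_j$ to $S_1^v$; else if $f(u_j\mid S_2^v)\ge \tau/k$ and $|S_2^v|<k$, add $u_j$ to $S_2^v$. After the stream ends, for each $v\in Q_n$ set $S_3^v=\mathrm{Unconstrained}(S_1^v)$, and return the set $S$ of largest $f$-value among all $S_1^v,S_2^v,S_3^v$, $v\in Q_n$. *)

theory Defs
  imports Complex_Main "HOL-Library.Monad_Syntax"
begin

section \<open>Submodular functions\<close>

definition submodular_on :: "'a set \<Rightarrow> ('a set \<Rightarrow> real) \<Rightarrow> bool" where
  "submodular_on N f \<longleftrightarrow>
     (\<forall>S T. S \<subseteq> N \<longrightarrow> T \<subseteq> N \<longrightarrow> f S + f T \<ge> f (S \<union> T) + f (S \<inter> T))"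

definition nonneg_on :: "'a set \<Rightarrow> ('a set \<Rightarrow> real) \<Rightarrow> bool" where
  "nonneg_on N f \<longleftrightarrow> (\<forall>S. S \<subseteq> N \<longrightarrow> f S \<ge> 0)"

definition OPT :: "'a set \<Rightarrow> ('a set \<Rightarrow> real) \<Rightarrow> nat \<Rightarrow> real" where
  "OPT N f k = Max (f ` {S. S \<subseteq> N \<and> card S \<le> k})"


section \<open>Deterministic programs with access to a value oracle\<close>

text \<open>
  A program never sees the set function itself: it can only ask for the value of one set at a
  time, and the continuation receives the answer.
\<close>

datatype ('a, 'b) oracle_prog =
    Return 'b
  | Query "'a set" "real \<Rightarrow> ('a, 'b) oracle_prog"

primrec bind_prog ::
  "('a, 'b) oracle_prog \<Rightarrow> ('b \<Rightarrow> ('a, 'c) oracle_prog) \<Rightarrow> ('a, 'c) oracle_prog" where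
  "bind_prog (Return x) g = g x"
| "bind_prog (Query S c) g = Query S (\<lambda>y. bind_prog (c y) g)"

adhoc_overloading Monad_Syntax.bind \<rightleftharpoons> bind_prog

abbreviation query :: "'a set \<Rightarrow> ('a, real) oracle_prog" where
  "query S \<equiv> Query S Return"

primrec foldM_prog ::
  "('x \<Rightarrow> 's \<Rightarrow> ('a, 's) oracle_prog) \<Rightarrow> 'x list \<Rightarrow> 's \<Rightarrow> ('a, 's) oracle_prog" where
  "foldM_prog g [] s = Return s"
| "foldM_prog g (x # xs) s = g x s \<bind> foldM_prog g xs"

primrec run :: "('a set \<Rightarrow> real) \<Rightarrow> ('a, 'b) oracle_prog \<Rightarrow> 'b" where
  "run f (Return x) = x"
| "run f (Query S c) = run f (c (f S))"

primrec num_queries :: "('a set \<Rightarrow> real) \<Rightarrow> ('a, 'b) oracle_prog \<Rightarrow> nat" where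
  "num_queries f (Return x) = 0"
| "num_queries f (Query S c) = Suc (num_queries f (c (f S)))"


section \<open>Streaming algorithms\<close>

text \<open>
  \<open>cells\<close> describes which stream elements a memory state holds: each member of \<open>cells s\<close> is
  one memory cell (its address together with the element in it), so that an element kept in
  several places is counted several times.
\<close>

record ('a, 's, 'c) streaming_alg =
  passes :: nat
  init :: 's
  step :: "'a \<Rightarrow> 's \<Rightarrow> ('a, 's) oracle_prog"
  finish :: "'s \<Rightarrow> ('a, 's \<times> 'a set) oracle_prog"
  cells :: "'s \<Rightarrow> ('c \<times> 'a) set"

definition arrivals :: "('a, 's, 'c) streaming_alg \<Rightarrow> 'a list \<Rightarrow> 'a list" where
  "arrivals A us = concat (replicate (passes A) us)"

text \<open>The memory state after the first \<open>j\<close> arrivals.\<close>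

definition state_after ::
  "('a, 's, 'c) streaming_alg \<Rightarrow> ('a set \<Rightarrow> real) \<Rightarrow> 'a list \<Rightarrow> nat \<Rightarrow> 's" where
  "state_after A f us j =
     fold (\<lambda>u s. run f (step A u s)) (take j (arrivals A us)) (init A)"

definition final_result ::
  "('a, 's, 'c) streaming_alg \<Rightarrow> ('a set \<Rightarrow> real) \<Rightarrow> 'a list \<Rightarrow> 's \<times> 'a set" where
  "final_result A f us =
     run f (finish A (state_after A f us (length (arrivals A us))))"

definition returned_set :: "('a, 's, 'c) streaming_alg \<Rightarrow> ('a set \<Rightarrow> real) \<Rightarrow> 'a list \<Rightarrow> 'a set" where
  "returned_set A f us = snd (final_result A f us)"

definition memory_states ::
  "('a, 's, 'c) streaming_alg \<Rightarrow> ('a set \<Rightarrow> real) \<Rightarrow> 'a list \<Rightarrow> 's set" where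
  "memory_states A f us =
     insert (fst (final_result A f us)) (state_after A f us ` {..length (arrivals A us)})"

text \<open>
  The summand 1 accounts for the arriving element that is currently being processed. Finiteness
  is required explicitly because \<open>card\<close> is 0 on infinite sets.
\<close>

definition stores_at_most ::
  "('a, 's, 'c) streaming_alg \<Rightarrow> ('a set \<Rightarrow> real) \<Rightarrow> 'a list \<Rightarrow> real \<Rightarrow> bool" where
  "stores_at_most A f us b \<longleftrightarrow>
     (\<forall>s \<in> memory_states A f us. finite (cells A s) \<and> real (card (cells A s)) + 1 \<le> b)"

definition queries_per_element_at_most ::
  "('a, 's, 'c) streaming_alg \<Rightarrow> ('a set \<Rightarrow> real) \<Rightarrow> 'a list \<Rightarrow> real \<Rightarrow> bool" where
  "queries_per_element_at_most A f us b \<longleftrightarrow>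
     (\<forall>j < length (arrivals A us).
        real (num_queries f (step A (arrivals A us ! j) (state_after A f us j))) \<le> b)"


section \<open>Unconstrained maximization\<close>

definition half_approx_unconstrained ::
  "'a set \<Rightarrow> ('a set \<Rightarrow> real) \<Rightarrow> ('a set \<Rightarrow> ('a, 'a set) oracle_prog) \<Rightarrow> bool" where
  "half_approx_unconstrained N f U \<longleftrightarrow>
     (\<forall>A. A \<subseteq> N \<longrightarrow> run f (U A) \<subseteq> A \<and> f (run f (U A)) \<ge> 1/2 * Max (f ` Pow A))"


section \<open>The algorithm\<close>

text \<open>
  \<open>sets s l v\<close> is $S_l^v$. A set that has not been created yet, or has been deleted, is empty.
\<close>

record 'a alg_state =
  max_single :: real
  sets :: "nat \<Rightarrow> real \<Rightarrow> 'a set"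

text \<open>For \<open>m = 0\<close> there are no guesses, as powers of \<open>1 + \<epsilon>\<close> are positive.\<close>

definition guesses :: "nat \<Rightarrow> real \<Rightarrow> real \<Rightarrow> real set" where
  "guesses k \<epsilon> m =
     {v. (\<exists>i::int. v = (1 + \<epsilon>) powi i) \<and> m \<le> v \<and> v \<le> 6 * real k * m}"

definition guess_list :: "nat \<Rightarrow> real \<Rightarrow> real \<Rightarrow> real list" where
  "guess_list k \<epsilon> m = sorted_list_of_set (guesses k \<epsilon> m)"

definition marginal :: "'a \<Rightarrow> 'a set \<Rightarrow> ('a, real) oracle_prog" where
  "marginal u T = do {
     x \<leftarrow> query (T \<union> {u});
     y \<leftarrow> query T;
     Return (x - y)
   }"

definition set_at ::
  "nat \<Rightarrow> real \<Rightarrow> 'a set \<Rightarrow> (nat \<Rightarrow> real \<Rightarrow> 'a set) \<Rightarrow> nat \<Rightarrow> real \<Rightarrow> 'a set" where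
  "set_at l v T S = S(l := (S l)(v := T))"

definition process_guess ::
  "nat \<Rightarrow> 'a \<Rightarrow> real \<Rightarrow> (nat \<Rightarrow> real \<Rightarrow> 'a set) \<Rightarrow> ('a, nat \<Rightarrow> real \<Rightarrow> 'a set) oracle_prog" where
  "process_guess k u v S =
     (let \<tau> = v / 6 in do {
       d1 \<leftarrow> marginal u (S 1 v);
       if d1 \<ge> \<tau> / real k \<and> card (S 1 v) < k
       then Return (set_at 1 v (S 1 v \<union> {u}) S)
       else do {
         d2 \<leftarrow> marginal u (S 2 v);
         if d2 \<ge> \<tau> / real k \<and> card (S 2 v) < k
         then Return (set_at 2 v (S 2 v \<union> {u}) S)
         else Return S
       }
     })"

definition step3 ::
  "nat \<Rightarrow> real \<Rightarrow> 'a \<Rightarrow> 'a alg_state \<Rightarrow> ('a, 'a alg_state) oracle_prog" where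
  "step3 k \<epsilon> u s = do {
     x \<leftarrow> query {u};
     let m = max (max_single s) x;
     let S = (\<lambda>l v. if v \<in> guesses k \<epsilon> m then sets s l v else {});
     S' \<leftarrow> foldM_prog (process_guess k u) (guess_list k \<epsilon> m) S;
     Return \<lparr>max_single = m, sets = S'\<rparr>
   }"

primrec best_from :: "'a set \<Rightarrow> real \<Rightarrow> 'a set list \<Rightarrow> ('a, 'a set) oracle_prog" where
  "best_from S x [] = Return S"
| "best_from S x (T # Ts) = do {
     y \<leftarrow> query T;
     if y > x then best_from T y Ts else best_from S x Ts
   }"

text \<open>If there are no candidates, the empty set is returned.\<close>

fun best_of :: "'a set list \<Rightarrow> ('a, 'a set) oracle_prog" where
  "best_of [] = Return {}"
| "best_of (S # Ss) = do { x \<leftarrow> query S; best_from S x Ss }"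

definition finish3 ::
  "nat \<Rightarrow> real \<Rightarrow> ('a set \<Rightarrow> ('a, 'a set) oracle_prog) \<Rightarrow>
     'a alg_state \<Rightarrow> ('a, 'a alg_state \<times> 'a set) oracle_prog" where
  "finish3 k \<epsilon> U s = do {
     let vs = guess_list k \<epsilon> (max_single s);
     S \<leftarrow> foldM_prog (\<lambda>v S. do { T \<leftarrow> U (S 1 v); Return (set_at 3 v T S) }) vs (sets s);
     R \<leftarrow> best_of (concat (map (\<lambda>v. [S 1 v, S 2 v, S 3 v]) vs));
     Return (s\<lparr>sets := S\<rparr>, R)
   }"

definition alg3 ::
  "nat \<Rightarrow> real \<Rightarrow> ('a set \<Rightarrow> ('a, 'a set) oracle_prog) \<Rightarrow>
     ('a, 'a alg_state, nat \<times> real) streaming_alg" where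
  "alg3 k \<epsilon> U =
     \<lparr>passes = 1,
      init = \<lparr>max_single = 0, sets = (\<lambda>_ _. {})\<rparr>,
      step = step3 k \<epsilon>,
      finish = finish3 k \<epsilon> U,
      cells = (\<lambda>s. {((l, v), u). u \<in> sets s l v})\<rparr>"

end

theory Submission imports Defs begin

text \<open>
  Let \<open>Y\<close> be an optimal set and \<open>A\<close>, \<open>B\<close> the two sets of a guess \<open>v\<close> with
  \<open>f Y \<le> v \<le> (1 + \<epsilon>) * f Y\<close>. If one of them is full, its \<open>k\<close> marginals of size at least
  \<open>v / (6 k)\<close> already add up to \<open>f Y / 6\<close>. Otherwise every element of \<open>Y - A\<close> was rejected by \<open>A\<close>,
  and every element of \<open>Y - A - B\<close> by \<open>B\<close>, so that \<open>f (A \<union> Y) \<le> f A + v / 6\<close> and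
  \<open>f (B \<union> (Y - A)) \<le> f B + v / 6\<close>. As \<open>A\<close> and \<open>B\<close> are disjoint, submodularity bounds \<open>f (Y - A)\<close>
  by the sum of the two left-hand sides, while the unconstrained subroutine returns \<open>T \<subseteq> A\<close> with
  \<open>2 * f T \<ge> f (A \<inter> Y)\<close>. Together \<open>f Y \<le> f A + f B + 2 * f T + v / 3\<close>, so one of the three sets has
  value at least \<open>(1/6 - \<epsilon>/12) * f Y\<close>.
\<close>

section \<open>Running oracle programs\<close>

lemma run_bind [simp]: "run f (bind_prog p g) = run f (g (run f p))"
  by (induction p) auto

lemma num_queries_bind [simp]:
  "num_queries f (bind_prog p g) = num_queries f p + num_queries f (g (run f p))"
  by (induction p) auto

lemma run_foldM: "run f (foldM_prog g xs s) = fold (\<lambda>x s. run f (g x s)) xs s"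
  by (induction xs arbitrary: s) auto

lemma num_queries_foldM_le:
  assumes "\<And>x s. num_queries f (g x s) \<le> b"
  shows "num_queries f (foldM_prog g xs s) \<le> b * length xs"
proof (induction xs arbitrary: s)
  case (Cons x xs)
  then show ?case using add_mono[OF assms Cons.IH] by simp
qed simp

text \<open>\<open>x\<close> caches the value of the current champion \<open>S\<close>. The equation
  survives every replacement, so the induction generalizes over both.\<close>

lemma run_best_from:
  assumes "x = f S"
  shows "run f (best_from S x Ts) \<in> insert S (set Ts) \<and>
    (\<forall>T \<in> insert S (set Ts). f T \<le> f (run f (best_from S x Ts)))"
  using assms
proof (induction Ts arbitrary: S x)
  case (Cons T Ts)
  show ?case
  proof (cases "f T > x")
    case True
    with Cons.IH[of "f T" T] Cons.prems show ?thesis by force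
  next
    case False
    with Cons.IH[of x S] Cons.prems show ?thesis by force
  qed
qed simp

lemma run_best_of:
  assumes "Ss \<noteq> []"
  shows "run f (best_of Ss) \<in> set Ss" "T \<in> set Ss \<Longrightarrow> f T \<le> f (run f (best_of Ss))"
  using assms run_best_from[OF refl, of f] by (cases Ss; force)+


section \<open>Submodular functions\<close>

lemma submodular_onD:
  assumes "submodular_on N f" "S \<subseteq> N" "T \<subseteq> N"
  shows "f (S \<union> T) + f (S \<inter> T) \<le> f S + f T"
  using assms unfolding submodular_on_def by blast

lemma nonneg_onD: "nonneg_on N f \<Longrightarrow> S \<subseteq> N \<Longrightarrow> 0 \<le> f S"
  unfolding nonneg_on_def by blast

text \<open>Diminishing returns: submodularity for the pair \<open>insert u A\<close> and
  \<open>B\<close>, whose intersection is \<open>A\<close> because \<open>u\<close> lies outside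
  \<open>B\<close>.\<close>

lemma submodular_marginal_antimono:
  assumes "submodular_on N f" "A \<subseteq> B" "B \<subseteq> N" "u \<in> N" "u \<notin> B"
  shows "f (insert u B) - f B \<le> f (insert u A) - f A"
proof -
  have "insert u A \<union> B = insert u B" "insert u A \<inter> B = A" using assms by auto
  then show ?thesis using submodular_onD[OF assms(1), of "insert u A" B] assms
    by (auto simp: algebra_simps)
qed

text \<open>The elements of \<open>Y\<close> are added one at a time; each gains no more over the
  grown set than over \<open>A\<close> itself.\<close>

lemma submodular_union_le:
  assumes "submodular_on N f" "A \<subseteq> N" "finite Y" "Y \<subseteq> N"
    and "\<And>u. u \<in> Y \<Longrightarrow> f (insert u A) - f A \<le> c"
  shows "f (A \<union> Y) \<le> f A + real (card Y) * c"
  using assms(3-)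
proof (induction Y)
  case (insert u Y)
  have u: "f (insert u A) - f A \<le> c" using insert.prems by simp
  have step: "f (A \<union> insert u Y) - f (A \<union> Y) \<le> c"
  proof (cases "u \<in> A")
    \<comment> \<open>Nothing is added here, and the hypothesis on \<open>u\<close> degenerates to
      \<open>0 \<le> c\<close>.\<close>
    case True
    then show ?thesis using u by (simp add: insert_absorb)
  next
    case False
    then have "f (insert u (A \<union> Y)) - f (A \<union> Y) \<le> f (insert u A) - f A"
      using insert assms(2) by (intro submodular_marginal_antimono[OF assms(1)]) auto
    then show ?thesis using u by simp
  qed
  have "f (A \<union> Y) \<le> f A + real (card Y) * c" using insert by auto
  with step insert.hyps show ?case by (simp add: algebra_simps)
qed simp

text \<open>Bounds a nonempty optimum by \<open>k\<close> times the best singleton, which determines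
  how far up the guesses must reach.\<close>

lemma submodular_le_card_mult:
  assumes "submodular_on N f" "nonneg_on N f" "finite Y" "Y \<noteq> {}" "Y \<subseteq> N"
    and "\<And>u. u \<in> Y \<Longrightarrow> f {u} \<le> m"
  shows "f Y \<le> real (card Y) * m"
proof -
  have "f ({} \<union> Y) \<le> f {} + real (card Y) * (m - f {})"
    using assms by (intro submodular_union_le[OF assms(1)]) auto
  \<comment> \<open>\<open>f {}\<close> is added once and subtracted \<open>card Y\<close> times, so
    \<open>card Y\<close> must be at least 1.\<close>
  moreover have "1 * f {} \<le> real (card Y) * f {}"
    using assms nonneg_onD[OF assms(2)] card_gt_0_iff[of Y]
    by (intro mult_right_mono) auto
  ultimately show ?thesis by (simp add: algebra_simps)
qed


section \<open>A single guess\<close>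

text \<open>The effect of \<open>process_guess\<close> with the oracle stripped off:
  \<open>A\<close> and \<open>B\<close> are the two sets of one guess \<open>v\<close>, and
  \<open>c\<close> stands for \<open>v / 6 / real k\<close>.\<close>

definition threshold_step ::
  "('a set \<Rightarrow> real) \<Rightarrow> nat \<Rightarrow> real \<Rightarrow> 'a \<Rightarrow> 'a set \<Rightarrow> 'a set \<Rightarrow> 'a set \<times> 'a set" where
  "threshold_step f k c u A B =
     (if c \<le> f (insert u A) - f A \<and> card A < k then (insert u A, B)
      else if c \<le> f (insert u B) - f B \<and> card B < k then (A, insert u B)
      else (A, B))"

text \<open>The sums of accepted marginals start at \<open>f {}\<close>, which may be positive.
  Keeping this term later settles the case of an empty optimum.\<close>

definition threshold_inv ::
  "('a set \<Rightarrow> real) \<Rightarrow> nat \<Rightarrow> real \<Rightarrow> 'a set \<Rightarrow> 'a set \<Rightarrow> 'a set \<Rightarrow> bool" where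
  "threshold_inv f k c X A B \<longleftrightarrow>
     A \<subseteq> X \<and> B \<subseteq> X \<and> A \<inter> B = {} \<and> card A \<le> k \<and> card B \<le> k \<and>
     f {} + real (card A) * c \<le> f A \<and> f {} + real (card B) * c \<le> f B"

text \<open>\<open>B\<close> is offered only what \<open>A\<close> rejected, hence the escape
  \<open>u \<in> A\<close> in the second line. A full set promises nothing about marginals.\<close>

definition saturated ::
  "('a set \<Rightarrow> real) \<Rightarrow> nat \<Rightarrow> real \<Rightarrow> 'a set \<Rightarrow> 'a set \<Rightarrow> 'a set \<Rightarrow> bool" where
  "saturated f k c X A B \<longleftrightarrow>
     (\<forall>u\<in>X. (u \<in> A \<or> card A = k \<or> f (insert u A) - f A \<le> c) \<and>
            (u \<in> A \<or> u \<in> B \<or> card B = k \<or> f (insert u B) - f B \<le> c))"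

lemma threshold_inv_empty: "threshold_inv f k c X {} {}"
  by (simp add: threshold_inv_def)

text \<open>As \<open>u\<close> is new, the set that receives it grows by exactly one element and
  its value by at least \<open>c\<close>; newness also keeps \<open>A\<close> and \<open>B\<close>
  disjoint.\<close>

lemma threshold_inv_step:
  assumes "threshold_inv f k c X A B" "finite X" "u \<notin> X" "threshold_step f k c u A B = (A', B')"
  shows "threshold_inv f k c (insert u X) A' B'"
proof -
  have fin: "finite A" "finite B" and nin: "u \<notin> A" "u \<notin> B"
    using assms(1,2,3) finite_subset unfolding threshold_inv_def by blast+
  show ?thesis
    using assms(1,3,4) fin nin unfolding threshold_inv_def threshold_step_def
    by (auto simp: algebra_simps split: if_splits)
qed

text \<open>Marginals only shrink while the sets grow, so old rejections stay justified; full sets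
  no longer change; and \<open>u\<close> itself has just been tested.\<close>

lemma saturated_step:
  assumes sub: "submodular_on N f" and X: "insert u X \<subseteq> N" "finite X" "u \<notin> X"
    and inv: "threshold_inv f k c X A B" and sat: "saturated f k c X A B"
    and step: "threshold_step f k c u A B = (A', B')"
  shows "saturated f k c (insert u X) A' B'"
proof -
  have inc: "A \<subseteq> A'" "B \<subseteq> B'" "A' \<subseteq> insert u X" "B' \<subseteq> insert u X"
    using step inv unfolding threshold_step_def threshold_inv_def by (auto split: if_splits)
  have full: "A' = A" if "card A = k" using that step
    unfolding threshold_step_def by (auto split: if_splits)
  have full2: "B' = B" if "card B = k" using that step
    unfolding threshold_step_def by (auto split: if_splits)
  \<comment> \<open>For \<open>w = u\<close> this turns a failed test \<open>card A < k\<close> into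
    \<open>card A = k\<close>, and likewise for \<open>B\<close>.\<close>
  have le: "card A \<le> k" "card B \<le> k" using inv unfolding threshold_inv_def by auto
  have marg: "f (insert w A') - f A' \<le> f (insert w A) - f A" if "w \<in> insert u X" "w \<notin> A'" for w
    using that inc X by (intro submodular_marginal_antimono[OF sub]) auto
  have marg2: "f (insert w B') - f B' \<le> f (insert w B) - f B" if "w \<in> insert u X" "w \<notin> B'" for w
    using that inc X by (intro submodular_marginal_antimono[OF sub]) auto
  show ?thesis
    unfolding saturated_def
  proof (intro ballI)
    fix w assume w: "w \<in> insert u X"
    show "(w \<in> A' \<or> card A' = k \<or> f (insert w A') - f A' \<le> c) \<and>
          (w \<in> A' \<or> w \<in> B' \<or> card B' = k \<or> f (insert w B') - f B' \<le> c)"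
    proof (cases "w = u")
      case True
      then show ?thesis using step le unfolding threshold_step_def by (auto split: if_splits)
    next
      case False
      then have "(w \<in> A \<or> card A = k \<or> f (insert w A) - f A \<le> c) \<and>
          (w \<in> A \<or> w \<in> B \<or> card B = k \<or> f (insert w B) - f B \<le> c)"
        using w sat unfolding saturated_def by auto
      then show ?thesis using marg[OF w] marg2[OF w] inc full full2 by fastforce
    qed
  qed
qed

lemma threshold_approx:
  assumes sub: "submodular_on N f" and nn: "nonneg_on N f" and fin: "finite N"
    and inv: "threshold_inv f k c N A B" and sat: "saturated f k c N A B"
    and not_full: "card A < k" "card B < k" and c: "0 \<le> c"
    and Y: "Y \<subseteq> N" "card Y \<le> k"
    and T: "1/2 * Max (f ` Pow A) \<le> f T"
  shows "f Y \<le> f A + f B + 2 * f T + 2 * (real k * c)"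
proof -
  have AB: "A \<subseteq> N" "B \<subseteq> N" "A \<inter> B = {}" using inv unfolding threshold_inv_def by auto
  have finY: "finite Y" and finA: "finite A" using finite_subset[OF _ fin] Y AB by auto
  \<comment> \<open>Elements of \<open>Y\<close> inside \<open>A\<close> have marginal 0, which
    \<open>c\<close> bounds as well. For the others \<open>sat\<close> applies, since
    \<open>A\<close> is not full.\<close>
  have "f (A \<union> Y) \<le> f A + real (card Y) * c"
    using sat not_full c Y AB finY unfolding saturated_def
    by (intro submodular_union_le[OF sub]) (force simp: insert_absorb)+
  \<comment> \<open>\<open>A\<close> is removed from \<open>Y\<close> because \<open>sat\<close>
    says nothing about the marginal over \<open>B\<close> of an element of \<open>A\<close>.\<close>
  moreover have "f (B \<union> (Y - A)) \<le> f B + real (card (Y - A)) * c"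
    using sat not_full c Y AB finY unfolding saturated_def
    by (intro submodular_union_le[OF sub]) (force simp: insert_absorb)+
  moreover have "real (card Y) * c \<le> real k * c" "real (card (Y - A)) * c \<le> real k * c"
    using Y c card_mono[OF finY, of "Y - A"] by (auto intro!: mult_right_mono)
  \<comment> \<open>Disjointness of \<open>A\<close> and \<open>B\<close> makes the two enlarged
    sets meet exactly in \<open>Y - A\<close>; the value of their union is dropped by
    nonnegativity.\<close>
  moreover have "f (Y - A) \<le> f (A \<union> Y) + f (B \<union> (Y - A))"
  proof -
    have "(A \<union> Y) \<inter> (B \<union> (Y - A)) = Y - A" using AB by auto
    moreover have "0 \<le> f ((A \<union> Y) \<union> (B \<union> (Y - A)))"
      using AB Y by (intro nonneg_onD[OF nn]) auto
    moreover have "A \<union> Y \<subseteq> N" "B \<union> (Y - A) \<subseteq> N" using AB Y by auto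
    ultimately show ?thesis
      using submodular_onD[OF sub, of "A \<union> Y" "B \<union> (Y - A)"] by simp
  qed
  moreover have "f Y \<le> f (Y - A) + f (A \<inter> Y)"
  proof -
    have "(Y - A) \<union> (A \<inter> Y) = Y" "(Y - A) \<inter> (A \<inter> Y) = {}" by auto
    moreover have "Y - A \<subseteq> N" "A \<inter> Y \<subseteq> N" using AB Y by auto
    ultimately show ?thesis
      using submodular_onD[OF sub, of "Y - A" "A \<inter> Y"] nonneg_onD[OF nn, of "{}"] by simp
  qed
  moreover have "f (A \<inter> Y) \<le> 2 * f T"
  proof -
    have "f (A \<inter> Y) \<le> Max (f ` Pow A)" using finA by (intro Max_ge) auto
    then show ?thesis using T by simp
  qed
  ultimately show ?thesis by linarith
qed


section \<open>The set of guesses\<close>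

lemma guesses_pos: "\<epsilon> > 0 \<Longrightarrow> v \<in> guesses k \<epsilon> m \<Longrightarrow> 0 < v"
  unfolding guesses_def by auto

lemma guesses_nonpos:
  assumes "\<epsilon> > 0" "m \<le> 0"
  shows "guesses k \<epsilon> m = {}"
proof -
  have "6 * real k * m \<le> 0" using assms by (simp add: mult_nonneg_nonpos)
  then have "v \<le> 0" if "v \<in> guesses k \<epsilon> m" for v
    using that unfolding guesses_def by (blast intro: order_trans)
  then show ?thesis using guesses_pos[OF assms(1)] by force
qed

text \<open>Rounding the logarithm of \<open>x\<close> up to an integer costs at most one factor
  \<open>1 + \<epsilon>\<close>.\<close>

lemma exists_guess:
  fixes \<epsilon> x :: real
  assumes "\<epsilon> > 0" "x > 0"
  obtains i :: int where "x \<le> (1 + \<epsilon>) powi i" "(1 + \<epsilon>) powi i \<le> (1 + \<epsilon>) * x"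
proof -
  define i where "i = \<lceil>log (1 + \<epsilon>) x\<rceil>"
  have pw: "(1 + \<epsilon>) powi i = (1 + \<epsilon>) powr real_of_int i"
    using assms by (simp add: powr_real_of_int')
  have "x = (1 + \<epsilon>) powr log (1 + \<epsilon>) x" using assms by simp
  also have "\<dots> \<le> (1 + \<epsilon>) powr real_of_int i"
    using assms unfolding i_def by (intro powr_mono) auto
  finally have 1: "x \<le> (1 + \<epsilon>) powi i" using pw by simp
  have "(1 + \<epsilon>) powr real_of_int i \<le> (1 + \<epsilon>) powr (1 + log (1 + \<epsilon>) x)"
    using assms unfolding i_def by (intro powr_mono) linarith+
  also have "\<dots> = (1 + \<epsilon>) * x" using assms by (simp add: powr_add)
  finally have "(1 + \<epsilon>) powi i \<le> (1 + \<epsilon>) * x" using pw by simp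
  with 1 show thesis by (rule that)
qed

text \<open>On the logarithmic scale the window has length
  \<open>log (1 + \<epsilon>) (6 * real k)\<close> for every positive \<open>m\<close>, and an
  interval contains at most one integer more than its length.\<close>

lemma guesses_card:
  assumes "\<epsilon> > 0" "k \<ge> 1"
  shows "finite (guesses k \<epsilon> m)" "real (card (guesses k \<epsilon> m)) \<le> log (1 + \<epsilon>) (6 * real k) + 1"
proof -
  \<comment> \<open>Keeps the bound nonnegative when no power lies in the window.\<close>
  have log0: "0 \<le> log (1 + \<epsilon>) (6 * real k)" using assms by simp
  have "finite (guesses k \<epsilon> m) \<and> real (card (guesses k \<epsilon> m)) \<le> log (1 + \<epsilon>) (6 * real k) + 1"
  proof (cases "m \<le> 0")
    case True
    then show ?thesis using guesses_nonpos[OF assms(1) True] log0 by simp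
  next
    case False
    define I where "I = {\<lceil>log (1 + \<epsilon>) m\<rceil>..\<lfloor>log (1 + \<epsilon>) (6 * real k * m)\<rfloor>}"
    have sub: "guesses k \<epsilon> m \<subseteq> (\<lambda>i. (1 + \<epsilon>) powi i) ` I"
    proof
      fix v assume "v \<in> guesses k \<epsilon> m"
      then obtain i :: int where i: "v = (1 + \<epsilon>) powi i" "m \<le> v" "v \<le> 6 * real k * m"
        unfolding guesses_def by auto
      have "log (1 + \<epsilon>) v = real_of_int i"
        using assms i(1) by (simp add: powr_real_of_int'[symmetric])
      moreover have "log (1 + \<epsilon>) m \<le> log (1 + \<epsilon>) v" "log (1 + \<epsilon>) v \<le> log (1 + \<epsilon>) (6 * real k * m)"
        using i assms False by auto
      ultimately have "i \<in> I" unfolding I_def by (simp add: ceiling_le_iff le_floor_iff)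
      then show "v \<in> (\<lambda>i. (1 + \<epsilon>) powi i) ` I" using i by auto
    qed
    have fin: "finite I" unfolding I_def by simp
    have "card (guesses k \<epsilon> m) \<le> card I"
      using sub fin by (meson card_image_le card_mono finite_imageI le_trans)
    moreover have "log (1 + \<epsilon>) (6 * real k * m) = log (1 + \<epsilon>) (6 * real k) + log (1 + \<epsilon>) m"
      using assms False by (intro log_mult_pos) auto
    then have "real (card I) \<le> log (1 + \<epsilon>) (6 * real k) + 1"
      unfolding I_def using log0 by simp linarith
    ultimately show ?thesis using finite_subset[OF sub] fin by simp
  qed
  then show "finite (guesses k \<epsilon> m)" "real (card (guesses k \<epsilon> m)) \<le> log (1 + \<epsilon>) (6 * real k) + 1"
    by auto
qed

text \<open>Turns logarithms to base \<open>1 + \<epsilon>\<close> into a factor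
  \<open>1 / \<epsilon>\<close>. For large \<epsilon> the logarithm falls behind every linear
  function, hence the cap at 1.\<close>

lemma ln_one_plus_ge_half_min:
  fixes \<epsilon> :: real
  assumes "\<epsilon> > 0"
  shows "min 1 \<epsilon> / 2 \<le> ln (1 + \<epsilon>)"
proof -
  define x where "x = min 1 \<epsilon>"
  have x: "0 < x" "x \<le> 1" "x \<le> \<epsilon>" using assms by (auto simp: x_def)
  have "ln (1 / (1 + x)) \<le> 1 / (1 + x) - 1" using x by (intro ln_le_minus_one) auto
  then have "x / (1 + x) \<le> ln (1 + x)" using x by (simp add: ln_div field_simps)
  moreover have "x / 2 \<le> x / (1 + x)" using x by (intro divide_left_mono) auto
  moreover have "ln (1 + x) \<le> ln (1 + \<epsilon>)" using x by simp
  ultimately show ?thesis unfolding x_def by linarith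
qed

text \<open>The 7 is 6 + 1: \<open>ln (6 * real k) \<le> 3 * L\<close> is divided by
  \<open>\<mu> / 2\<close>, and the additive 1 is absorbed by
  \<open>1 \<le> L / \<mu>\<close>.\<close>

lemma guesses_card_bound:
  assumes "\<epsilon> > 0" "k \<ge> 1"
  shows "real (card (guesses k \<epsilon> m)) \<le> 7 * (max 1 (log 2 (real k)) / min 1 \<epsilon>)"
proof -
  define L where "L = max 1 (log 2 (real k))"
  define \<mu> where "\<mu> = min 1 \<epsilon>"
  have mu: "0 < \<mu>" "\<mu> \<le> 1" "\<mu> / 2 \<le> ln (1 + \<epsilon>)"
    using assms ln_one_plus_ge_half_min[of \<epsilon>] by (auto simp: \<mu>_def)
  have L1: "1 \<le> L" by (simp add: L_def)
  have "ln (real k) \<le> log 2 (real k)"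
  proof -
    have "ln (real k) * ln 2 \<le> ln (real k) * 1"
      using assms ln_le_minus_one[of "2::real"] by (intro mult_left_mono) auto
    then show ?thesis by (simp add: log_def field_simps)
  qed
  then have lnk: "ln (real k) \<le> L" by (simp add: L_def)
  have "ln (6::real) \<le> 2"
  proof -
    \<comment> \<open>The quadratic Taylor polynomial gives \<open>5/2 \<le> exp 1\<close>, and the
      square of 5/2 is 6.25.\<close>
    have "(6::real) \<le> exp 1 ^ 2"
      using exp_ge_add_one_self[of "1::real"] exp_lower_Taylor_quadratic[of "1::real"]
        power_mono[of "5/2" "exp 1 :: real" 2] by (simp add: power2_eq_square)
    then have "ln 6 \<le> ln (exp (2::real))"
      by (subst ln_le_cancel_iff) (auto simp: exp_of_nat_mult[symmetric] power2_eq_square mult_exp_exp)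
    then show ?thesis by simp
  qed
  then have "ln (6 * real k) \<le> 3 * L" using lnk L1 assms by (simp add: ln_mult)
  then have "log (1 + \<epsilon>) (6 * real k) \<le> 3 * L / ln (1 + \<epsilon>)"
    using assms unfolding log_def by (intro divide_right_mono) auto
  also have "\<dots> \<le> 3 * L / (\<mu> / 2)" using mu L1 by (intro divide_left_mono) auto
  finally have "log (1 + \<epsilon>) (6 * real k) \<le> 6 * (L / \<mu>)" by (simp add: field_simps)
  moreover have "1 \<le> L / \<mu>" using mu L1 by (simp add: le_divide_eq)
  ultimately show ?thesis using guesses_card(2)[OF assms, of m] unfolding L_def \<mu>_def by linarith
qed


section \<open>The algorithm\<close>

lemma run_process_guess:
  "run f (process_guess k u v S) =
     (case threshold_step f k (v / 6 / real k) u (S 1 v) (S 2 v) of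
        (A, B) \<Rightarrow> set_at 1 v A (set_at 2 v B S))"
  unfolding process_guess_def marginal_def threshold_step_def set_at_def
  by (auto simp: Let_def fun_eq_iff)

lemma num_queries_process_guess: "num_queries f (process_guess k u v S) \<le> 4"
  unfolding process_guess_def marginal_def by (simp add: Let_def)

text \<open>Processing a guess reads and writes its own two entries only, so with distinct guesses
  every update sees the initial sets.\<close>

lemma fold_process_guess:
  assumes "distinct vs"
  shows "fold (\<lambda>v S. run f (process_guess k u v S)) vs S l w =
    (if w \<in> set vs \<and> l = 1 then fst (threshold_step f k (w / 6 / real k) u (S 1 w) (S 2 w))
     else if w \<in> set vs \<and> l = 2 then snd (threshold_step f k (w / 6 / real k) u (S 1 w) (S 2 w))
     else S l w)"
  using assms
proof (induction vs arbitrary: S)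
  case (Cons v vs)
  then show ?case
    by (auto simp: run_process_guess set_at_def split: prod.splits)
qed simp

text \<open>The loop reads level 1 and writes level 3, so each call of \<open>U\<close> sees the
  initial first set.\<close>

lemma fold_unconstrained:
  "fold (\<lambda>v S. run f (bind_prog (U (S 1 v)) (\<lambda>T. Return (set_at 3 v T S)))) vs S l w =
    (if l = 3 \<and> w \<in> set vs then run f (U (S 1 w)) else S l w)"
  by (induction vs arbitrary: S) (auto simp: set_at_def)

lemma set_guess_list:
  assumes "\<epsilon> > 0" "k \<ge> 1"
  shows "set (guess_list k \<epsilon> m) = guesses k \<epsilon> m" "distinct (guess_list k \<epsilon> m)"
    "length (guess_list k \<epsilon> m) = card (guesses k \<epsilon> m)"
  using guesses_card(1)[OF assms] unfolding guess_list_def by auto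

lemma run_step3:
  fixes f :: "'a set \<Rightarrow> real"
  assumes "\<epsilon> > 0" "k \<ge> 1"
  defines "m \<equiv> \<lambda>s u. max (max_single s) (f {u})"
  shows "max_single (run f (step3 k \<epsilon> u s)) = m s u"
    "v \<notin> guesses k \<epsilon> (m s u) \<Longrightarrow> sets (run f (step3 k \<epsilon> u s)) l v = {}"
    "l \<noteq> 1 \<Longrightarrow> l \<noteq> 2 \<Longrightarrow> sets s l v = {} \<Longrightarrow> sets (run f (step3 k \<epsilon> u s)) l v = {}"
    "v \<in> guesses k \<epsilon> (m s u) \<Longrightarrow>
      threshold_step f k (v / 6 / real k) u (sets s 1 v) (sets s 2 v) =
        (sets (run f (step3 k \<epsilon> u s)) 1 v, sets (run f (step3 k \<epsilon> u s)) 2 v)"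
  unfolding step3_def m_def
  by (simp_all add: Let_def run_foldM fold_process_guess set_guess_list[OF assms(1,2)])

text \<open>One query for the singleton and at most 4 per guess: 29 = 1 + 4 * 7, the 1 being
  absorbed by a ratio that is at least 1.\<close>

lemma num_queries_step3:
  assumes "\<epsilon> > 0" "k \<ge> 1"
  shows "real (num_queries f (step3 k \<epsilon> u s)) \<le> 29 * (max 1 (log 2 (real k)) / min 1 \<epsilon>)"
proof -
  define m where "m = max (max_single s) (f {u})"
  have "num_queries f (step3 k \<epsilon> u s) \<le> 1 + 4 * card (guesses k \<epsilon> m)"
    unfolding step3_def m_def
    using num_queries_foldM_le[of f "process_guess k u" 4, OF num_queries_process_guess]
    by (simp add: Let_def flip: set_guess_list(3)[OF assms])
  then have "real (num_queries f (step3 k \<epsilon> u s)) \<le> 1 + 4 * real (card (guesses k \<epsilon> m))"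
    by linarith
  moreover have "1 \<le> max 1 (log 2 (real k)) / min 1 \<epsilon>"
    using assms by (auto simp: le_divide_eq min_le_iff_disj)
  ultimately show ?thesis using guesses_card_bound[OF assms, of m] by linarith
qed

section \<open>The invariant along the stream\<close>

text \<open>The first conjunct records that a positive maximum is attained by a singleton, which
  later places it below the optimum. Saturation is claimed for live guesses only, since a deleted
  guess has lost its sets.\<close>

definition stream_inv ::
  "('a set \<Rightarrow> real) \<Rightarrow> nat \<Rightarrow> real \<Rightarrow> 'a set \<Rightarrow> 'a alg_state \<Rightarrow> bool" where
  "stream_inv f k \<epsilon> X s \<longleftrightarrow>
     max_single s \<in> insert 0 ((\<lambda>u. f {u}) ` X) \<and> 0 \<le> max_single s \<and>
     (\<forall>u\<in>X. f {u} \<le> max_single s) \<and>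
     (\<forall>l v. v \<notin> guesses k \<epsilon> (max_single s) \<or> l \<notin> {1, 2} \<longrightarrow> sets s l v = {}) \<and>
     (\<forall>v. threshold_inv f k (v / 6 / real k) X (sets s 1 v) (sets s 2 v)) \<and>
     (\<forall>v \<in> guesses k \<epsilon> (max_single s).
        saturated f k (v / 6 / real k) X (sets s 1 v) (sets s 2 v))"

text \<open>
  A guess that enters late has lost nothing: it exceeded \<open>6 k m\<close> until now, so no earlier element
  could have reached its threshold, not even relative to the empty set.
\<close>

lemma saturated_late_guess:
  assumes "nonneg_on N f" "k \<ge> 1" "\<And>u. u \<in> X \<Longrightarrow> f {u} \<le> m" "6 * real k * m < v"
  shows "saturated f k (v / 6 / real k) X {} {}"
proof -
  have "m \<le> v / 6 / real k" using assms by (simp add: field_simps)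
  moreover have "0 \<le> f {}" using assms nonneg_onD by blast
  ultimately show ?thesis using assms(3) unfolding saturated_def by force
qed

lemma stream_inv_init: "\<epsilon> > 0 \<Longrightarrow> stream_inv f k \<epsilon> {} \<lparr>max_single = 0, sets = \<lambda>_ _. {}\<rparr>"
  by (simp add: stream_inv_def threshold_inv_empty guesses_nonpos)

text \<open>A guess of the new window was live before or enters late with empty sets. Either way its
  pair was saturated before \<open>u\<close>, and the lemmas on a single guess carry it past
  \<open>u\<close>.\<close>

lemma stream_inv_step:
  assumes sub: "submodular_on N f" and nn: "nonneg_on N f" and k: "k \<ge> 1" and eps: "\<epsilon> > 0"
    and X: "insert u X \<subseteq> N" "finite X" "u \<notin> X" and inv: "stream_inv f k \<epsilon> X s"
  shows "stream_inv f k \<epsilon> (insert u X) (run f (step3 k \<epsilon> u s))"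
proof -
  define s' where "s' = run f (step3 k \<epsilon> u s)"
  define m where "m = max_single s"
  define m' where "m' = max m (f {u})"
  have m': "max_single s' = m'" and out: "\<And>v l. v \<notin> guesses k \<epsilon> m' \<Longrightarrow> sets s' l v = {}"
    and other: "\<And>v l. l \<noteq> 1 \<Longrightarrow> l \<noteq> 2 \<Longrightarrow> sets s l v = {} \<Longrightarrow> sets s' l v = {}"
    and upd: "\<And>v. v \<in> guesses k \<epsilon> m' \<Longrightarrow>
      threshold_step f k (v / 6 / real k) u (sets s 1 v) (sets s 2 v) = (sets s' 1 v, sets s' 2 v)"
    unfolding s'_def m'_def m_def by (fact run_step3[OF eps k])+
  have thr: "threshold_inv f k (v / 6 / real k) X (sets s 1 v) (sets s 2 v)" for v
    using inv unfolding stream_inv_def by blast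
  have mX: "f {w} \<le> m" if "w \<in> X" for w
    using inv that unfolding stream_inv_def m_def by blast
  have sat: "saturated f k (v / 6 / real k) X (sets s 1 v) (sets s 2 v)"
    if v: "v \<in> guesses k \<epsilon> m'" for v
  proof (cases "v \<in> guesses k \<epsilon> m")
    case True
    then show ?thesis using inv unfolding stream_inv_def m_def by blast
  next
    case False
    then have "sets s 1 v = {}" "sets s 2 v = {}"
      using inv unfolding stream_inv_def m_def by blast+
    \<comment> \<open>From \<open>m \<le> m'\<close> and \<open>m' \<le> v\<close>, the guess can
      have been missing only at the upper end: a guess dropped as too small never returns.\<close>
    moreover have "6 * real k * m < v" using v False unfolding guesses_def m'_def by auto
    ultimately show ?thesis using saturated_late_guess[OF nn k mX] by simp
  qed
  have "threshold_inv f k (v / 6 / real k) (insert u X) (sets s' 1 v) (sets s' 2 v)" for v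
    using threshold_inv_step[OF thr X(2,3) upd] out threshold_inv_empty by metis
  moreover have "saturated f k (v / 6 / real k) (insert u X) (sets s' 1 v) (sets s' 2 v)"
    if "v \<in> guesses k \<epsilon> m'" for v
    using saturated_step[OF sub X thr sat[OF that] upd[OF that]] .
  ultimately have "stream_inv f k \<epsilon> (insert u X) s'"
    using inv m' out other unfolding stream_inv_def m'_def m_def
    by (auto simp: max_def)
  then show ?thesis unfolding s'_def .
qed

lemma arrivals_alg3: "arrivals (alg3 k \<epsilon> U) us = us"
  by (simp add: arrivals_def alg3_def)

lemma stream_inv_state_after:
  assumes "submodular_on (set us) f" "nonneg_on (set us) f" "k \<ge> 1" "\<epsilon> > 0" "distinct us"
    and "j \<le> length us"
  shows "stream_inv f k \<epsilon> (set (take j us)) (state_after (alg3 k \<epsilon> U) f us j)"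
  using assms(6)
proof (induction j)
  case 0
  then show ?case using stream_inv_init[OF assms(4)]
    by (simp add: state_after_def alg3_def)
next
  case (Suc j)
  have take: "take (Suc j) us = take j us @ [us ! j]" using Suc.prems by (simp add: take_Suc_conv_app_nth)
  have st: "state_after (alg3 k \<epsilon> U) f us (Suc j) =
      run f (step3 k \<epsilon> (us ! j) (state_after (alg3 k \<epsilon> U) f us j))"
    unfolding state_after_def arrivals_alg3 take by (simp add: alg3_def)
  have "distinct (take (Suc j) us)" using assms(5) by simp
  then have nin: "us ! j \<notin> set (take j us)" unfolding take by simp
  have "insert (us ! j) (set (take j us)) \<subseteq> set us"
    using Suc.prems set_take_subset[of j us] by auto
  from stream_inv_step[OF assms(1-4) this _ nin] Suc show ?case
    unfolding st take by simp
qed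

section \<open>Memory\<close>

lemma stream_inv_sets:
  assumes "stream_inv f k \<epsilon> X s"
  shows "sets s 1 v \<subseteq> X" "sets s 2 v \<subseteq> X" "card (sets s 1 v) \<le> k" "card (sets s 2 v) \<le> k"
  using assms unfolding stream_inv_def threshold_inv_def by blast+

text \<open>Three sets of at most \<open>k\<close> elements for at most \<open>7 * R\<close> guesses
  give 21, and 1 more covers the arriving element. The larger 29 is shared with the query
  bound.\<close>

lemma cells_bound:
  assumes "\<epsilon> > 0" "k \<ge> 1"
    and "\<And>l v. sets s l v \<noteq> {} \<Longrightarrow> l \<in> {1, 2, 3} \<and> v \<in> guesses k \<epsilon> m"
    and "\<And>l v. finite (sets s l v)" "\<And>l v. card (sets s l v) \<le> k"
  shows "finite (cells (alg3 k \<epsilon> U) s) \<and> real (card (cells (alg3 k \<epsilon> U) s)) + 1 \<le>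
    29 * (real k * max 1 (log 2 (real k)) / min 1 \<epsilon>)"
proof -
  define I where "I = {1, 2, 3::nat} \<times> guesses k \<epsilon> m"
  define R where "R = max 1 (log 2 (real k)) / min 1 \<epsilon>"
  have finI: "finite I" unfolding I_def using guesses_card(1)[OF assms(1,2)] by simp
  have eq: "cells (alg3 k \<epsilon> U) s = Sigma I (\<lambda>(l, v). sets s l v)"
    using assms(3) by (fastforce simp: alg3_def I_def)
  have "card (Sigma I (\<lambda>(l, v). sets s l v)) = (\<Sum>(l, v)\<in>I. card (sets s l v))"
    using finI assms(4) by (subst card_SigmaI) (auto simp: case_prod_unfold)
  also have "\<dots> \<le> (\<Sum>i\<in>I. k)" using assms(5) by (intro sum_mono) auto
  also have "\<dots> = 3 * card (guesses k \<epsilon> m) * k" unfolding I_def by (simp add: card_cartesian_product)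
  finally have "real (card (cells (alg3 k \<epsilon> U) s)) \<le> real (3 * card (guesses k \<epsilon> m) * k)"
    unfolding eq by (simp only: of_nat_le_iff)
  also have "\<dots> = 3 * real k * real (card (guesses k \<epsilon> m))" by simp
  also have "\<dots> \<le> 3 * real k * (7 * R)"
    using guesses_card_bound[OF assms(1,2), of m] unfolding R_def by (intro mult_left_mono) auto
  finally have "real (card (cells (alg3 k \<epsilon> U) s)) \<le> 21 * (real k * R)" by simp
  moreover have "1 \<le> R"
    unfolding R_def using assms(1) by (auto simp: le_divide_eq min_le_iff_disj)
  then have "1 * 1 \<le> real k * R" using assms(2) by (intro mult_mono) auto
  moreover have "finite (cells (alg3 k \<epsilon> U) s)"
    unfolding eq using finI assms(4) by (intro finite_SigmaI) auto
  ultimately have "finite (cells (alg3 k \<epsilon> U) s) \<and>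
      real (card (cells (alg3 k \<epsilon> U) s)) + 1 \<le> 29 * (real k * R)" by linarith
  then show ?thesis unfolding R_def by simp
qed

section \<open>End of the stream and approximation ratio\<close>

lemma run_finish3:
  assumes "\<epsilon> > 0" "k \<ge> 1"
  defines "G \<equiv> \<lambda>s. guesses k \<epsilon> (max_single s)"
  shows "sets (fst (run f (finish3 k \<epsilon> U s))) l v =
      (if l = 3 \<and> v \<in> G s then run f (U (sets s 1 v)) else sets s l v)"
    "G s = {} \<Longrightarrow> snd (run f (finish3 k \<epsilon> U s)) = {}"
    "G s \<noteq> {} \<Longrightarrow> \<exists>v\<in>G s. snd (run f (finish3 k \<epsilon> U s)) \<in>
      {sets s 1 v, sets s 2 v, run f (U (sets s 1 v))}"
    "v \<in> G s \<Longrightarrow> T \<in> {sets s 1 v, sets s 2 v, run f (U (sets s 1 v))} \<Longrightarrow>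
      f T \<le> f (snd (run f (finish3 k \<epsilon> U s)))"
proof -
  define vs where "vs = guess_list k \<epsilon> (max_single s)"
  have vs: "set vs = G s" unfolding vs_def G_def using set_guess_list[OF assms(1,2)] by simp
  define S where "S = fold (\<lambda>v S. run f (bind_prog (U (S 1 v)) (\<lambda>T. Return (set_at 3 v T S)))) vs (sets s)"
  have S: "S l w = (if l = 3 \<and> w \<in> G s then run f (U (sets s 1 w)) else sets s l w)" for l w
    unfolding S_def fold_unconstrained vs by simp
  define Cs where "Cs = concat (map (\<lambda>v. [S 1 v, S 2 v, S 3 v]) vs)"
  have Cs: "set Cs = (\<Union>v\<in>G s. {sets s 1 v, sets s 2 v, run f (U (sets s 1 v))})"
    unfolding Cs_def by (auto simp: S vs)
  have R: "run f (finish3 k \<epsilon> U s) = (s\<lparr>sets := S\<rparr>, run f (best_of Cs))"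
    unfolding finish3_def Cs_def S_def vs_def by (simp add: Let_def run_foldM)
  show "sets (fst (run f (finish3 k \<epsilon> U s))) l v =
      (if l = 3 \<and> v \<in> G s then run f (U (sets s 1 v)) else sets s l v)"
    unfolding R using S by simp
  show "G s = {} \<Longrightarrow> snd (run f (finish3 k \<epsilon> U s)) = {}"
    unfolding R using Cs by simp
  show "G s \<noteq> {} \<Longrightarrow> \<exists>v\<in>G s. snd (run f (finish3 k \<epsilon> U s)) \<in>
      {sets s 1 v, sets s 2 v, run f (U (sets s 1 v))}"
    unfolding R using Cs run_best_of(1)[of Cs f] by fastforce
  show "v \<in> G s \<Longrightarrow> T \<in> {sets s 1 v, sets s 2 v, run f (U (sets s 1 v))} \<Longrightarrow>
      f T \<le> f (snd (run f (finish3 k \<epsilon> U s)))"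
    unfolding R using Cs run_best_of(2)[of Cs T f] by force
qed

text \<open>The two bounds on \<open>v\<close> serve different cases: \<open>f Y \<le> v\<close>
  when one of the sets is full, \<open>v \<le> (1 + \<epsilon>) * f Y\<close> when neither
  is.\<close>

lemma guess_approx:
  assumes sub: "submodular_on N f" and nn: "nonneg_on N f" and fin: "finite N"
    and k: "k \<ge> 1" and eps: "\<epsilon> > 0"
    and half: "half_approx_unconstrained N f U" and inv: "stream_inv f k \<epsilon> N s"
    and Y: "Y \<subseteq> N" "card Y \<le> k"
    and v: "v \<in> guesses k \<epsilon> (max_single s)" "f Y \<le> v" "v \<le> (1 + \<epsilon>) * f Y"
  shows "(1/6 - \<epsilon>) * f Y \<le> f (snd (run f (finish3 k \<epsilon> U s)))"
proof -
  define A where "A = sets s 1 v"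
  define B where "B = sets s 2 v"
  define c where "c = v / 6 / real k"
  define b where "b = f (snd (run f (finish3 k \<epsilon> U s)))"
  have le: "f A \<le> b" "f B \<le> b" "f (run f (U A)) \<le> b"
    unfolding b_def A_def B_def using run_finish3(4)[OF eps k v(1)] by auto
  have thr: "threshold_inv f k c N A B" and sat: "saturated f k c N A B"
    using inv v(1) unfolding stream_inv_def A_def B_def c_def by blast+
  have v0: "0 < v" using guesses_pos[OF eps v(1)] .
  have kc: "real k * c = v / 6" and c0: "0 \<le> c" using k v0 by (auto simp: c_def)
  have fY: "0 \<le> f Y" using nonneg_onD[OF nn] Y by blast
  have f0: "0 \<le> f {}" using nonneg_onD[OF nn] by blast
  have val: "f {} + real (card A) * c \<le> f A" "f {} + real (card B) * c \<le> f B"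
    and card: "card A \<le> k" "card B \<le> k" "A \<subseteq> N"
    using thr unfolding threshold_inv_def by auto
  have epsY: "0 \<le> \<epsilon> * f Y" using eps fY by simp
  have "(1/6 - \<epsilon>) * f Y \<le> b"
  proof (cases "card A = k \<or> card B = k")
    case True
    then have "v / 6 \<le> b" using val kc f0 le by auto
    then show ?thesis using v(2) epsY by (simp add: algebra_simps)
  next
    case False
    have "1/2 * Max (f ` Pow A) \<le> f (run f (U A))"
      using half card unfolding half_approx_unconstrained_def by blast
    with False card have "f Y \<le> f A + f B + 2 * f (run f (U A)) + 2 * (real k * c)"
      by (intro threshold_approx[OF sub nn fin thr sat _ _ c0 Y]) auto
    \<comment> \<open>With the upper bound on \<open>v\<close> this leaves
      \<open>b \<ge> (1/6 - \<epsilon>/12) * f Y\<close>, which implies the claim by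
      \<open>epsY\<close>.\<close>
    then have "f Y \<le> 4 * b + v / 3" using le kc by linarith
    then show ?thesis using v(3) epsY by (simp add: algebra_simps)
  qed
  then show ?thesis unfolding b_def .
qed

lemma finish3_approx:
  assumes sub: "submodular_on N f" and nn: "nonneg_on N f" and fin: "finite N"
    and k: "k \<ge> 1" and eps: "\<epsilon> > 0"
    and half: "half_approx_unconstrained N f U" and inv: "stream_inv f k \<epsilon> N s"
    and ret: "snd (run f (finish3 k \<epsilon> U s)) \<subseteq> N"
    and Y: "Y \<subseteq> N" "card Y \<le> k" and opt: "\<And>Z. Z \<subseteq> N \<Longrightarrow> card Z \<le> k \<Longrightarrow> f Z \<le> f Y"
  shows "(1/6 - \<epsilon>) * f Y \<le> f (snd (run f (finish3 k \<epsilon> U s)))"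
proof (cases "\<epsilon> \<ge> 1/6 \<or> f Y = 0")
  case True
  have "0 \<le> f Y" using nonneg_onD[OF nn] Y by blast
  then have "(1/6 - \<epsilon>) * f Y \<le> 0" using True by (auto simp: mult_nonpos_nonneg)
  also have "0 \<le> f (snd (run f (finish3 k \<epsilon> U s)))" using nonneg_onD[OF nn ret] .
  finally show ?thesis .
next
  case False
  define m where "m = max_single s"
  have fY: "0 < f Y" using False nonneg_onD[OF nn Y(1)] by simp
  have mN: "f {u} \<le> m" if "u \<in> N" for u using inv that unfolding stream_inv_def m_def by blast
  have m0: "0 \<le> m" and mrange: "m \<in> insert 0 ((\<lambda>u. f {u}) ` N)"
    using inv unfolding stream_inv_def m_def by blast+
  have m_le: "m \<le> f Y"
  \<comment> \<open>A nonzero \<open>m\<close> is the value of a singleton, which competes for the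
    optimum because \<open>k \<ge> 1\<close>.\<close>
  proof (cases "m = 0")
    case False
    then obtain u where "u \<in> N" "m = f {u}" using mrange by blast
    then show ?thesis using opt[of "{u}"] k by simp
  qed (use fY in simp)
  \<comment> \<open>In the remaining case \<open>\<epsilon> < 1/6\<close>, so the factor 6 in the
    window leaves room for rounding the guess up.\<close>
  have sixk: "(1 + \<epsilon>) * (real k * m) \<le> 6 * real k * m"
    using False m0 mult_right_mono[of "1 + \<epsilon>" 6 "real k * m"] by simp
  have small: "(1/6 - \<epsilon>) * f Y \<le> f Y" using fY eps by simp
  show ?thesis
  proof (cases "f Y \<le> real k * m")
    case True
    obtain i :: int where i: "f Y \<le> (1 + \<epsilon>) powi i" "(1 + \<epsilon>) powi i \<le> (1 + \<epsilon>) * f Y"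
      using exists_guess[OF eps fY] .
    have "(1 + \<epsilon>) * f Y \<le> (1 + \<epsilon>) * (real k * m)" using True eps by (intro mult_left_mono) auto
    then have "(1 + \<epsilon>) powi i \<in> guesses k \<epsilon> (max_single s)"
      using i m_le sixk unfolding guesses_def m_def by (auto intro!: exI[of _ i])
    then show ?thesis using guess_approx[OF sub nn fin k eps half inv Y] i by blast
  next
    case False
    \<comment> \<open>A nonempty optimum is at most \<open>real k * m\<close>. Only a positive
      \<open>f {}\<close> can exceed this, and then every first set is worth at least
      \<open>f {}\<close>; without guesses the empty set itself is returned.\<close>
    have "Y = {}"
    proof (rule ccontr)
      assume "Y \<noteq> {}"
      then have "f Y \<le> real (card Y) * m"
        using Y mN finite_subset[OF _ fin] by (intro submodular_le_card_mult[OF sub nn]) auto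
      also have "\<dots> \<le> real k * m" using Y m0 by (intro mult_right_mono) auto
      finally show False using False by simp
    qed
    show ?thesis
    proof (cases "guesses k \<epsilon> m = {}")
      case True
      then show ?thesis using run_finish3(2)[OF eps k, of s f U] \<open>Y = {}\<close> small
        unfolding m_def by simp
    next
      case False
      then obtain v where v: "v \<in> guesses k \<epsilon> m" by auto
      have "f {} + real (card (sets s 1 v)) * (v / 6 / real k) \<le> f (sets s 1 v)"
        using inv unfolding stream_inv_def threshold_inv_def by blast
      moreover have "0 \<le> real (card (sets s 1 v)) * (v / 6 / real k)"
        using guesses_pos[OF eps v] by simp
      moreover have "f (sets s 1 v) \<le> f (snd (run f (finish3 k \<epsilon> U s)))"
        using run_finish3(4)[OF eps k, of v s] v unfolding m_def by blast
      ultimately show ?thesis using small \<open>Y = {}\<close> by simp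
    qed
  qed
qed

section \<open>Assembling the guarantees\<close>

lemma OPT_attained:
  assumes "finite N"
  obtains Y where "Y \<subseteq> N" "card Y \<le> k" "OPT N f k = f Y"
    "\<And>Z. Z \<subseteq> N \<Longrightarrow> card Z \<le> k \<Longrightarrow> f Z \<le> f Y"
proof -
  let ?F = "f ` {S. S \<subseteq> N \<and> card S \<le> k}"
  have fin: "finite ?F" using assms by simp
  have "{} \<in> {S. S \<subseteq> N \<and> card S \<le> k}" by simp
  then have "OPT N f k \<in> ?F" unfolding OPT_def using fin by (intro Max_in) blast+
  moreover have "f Z \<le> OPT N f k" if "Z \<subseteq> N" "card Z \<le> k" for Z
    unfolding OPT_def using fin that by (intro Max_ge) auto
  ultimately show thesis using that by fastforce
qed

text \<open>Each O-bound becomes one constant, uniform in all inputs. The cutoffs at 1 keep the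
  bounds meaningful for \<open>k = 1\<close> and for large \<epsilon>, where the raw expressions
  fall below the single query and the single element that every arrival costs.\<close>

theorem theorem3:
  "\<exists>C > 0. \<forall>(us :: 'a list) (f :: 'a set \<Rightarrow> real) (k :: nat) (\<epsilon> :: real)
       (U :: 'a set \<Rightarrow> ('a, 'a set) oracle_prog).
     distinct us \<longrightarrow> nonneg_on (set us) f \<longrightarrow> submodular_on (set us) f \<longrightarrow>
     k \<ge> 1 \<longrightarrow> \<epsilon> > 0 \<longrightarrow> half_approx_unconstrained (set us) f U \<longrightarrow>
     returned_set (alg3 k \<epsilon> U) f us \<subseteq> set us \<and>
     card (returned_set (alg3 k \<epsilon> U) f us) \<le> k \<and>
     f (returned_set (alg3 k \<epsilon> U) f us) \<ge> (1/6 - \<epsilon>) * OPT (set us) f k \<and>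
     passes (alg3 k \<epsilon> U) = 1 \<and>
     stores_at_most (alg3 k \<epsilon> U) f us
       (C * (real k * max 1 (log 2 (real k)) / min 1 \<epsilon>)) \<and>
     queries_per_element_at_most (alg3 k \<epsilon> U) f us
       (C * (max 1 (log 2 (real k)) / min 1 \<epsilon>))"
proof (intro exI[of _ 29] conjI allI impI)
  show "(0::real) < 29" by simp
next
  fix us :: "'a list" and f :: "'a set \<Rightarrow> real" and k :: nat and \<epsilon> :: real
    and U :: "'a set \<Rightarrow> ('a, 'a set) oracle_prog"
  assume dist: "distinct us" and nn: "nonneg_on (set us) f" and sub: "submodular_on (set us) f"
    and k: "k \<ge> 1" and eps: "\<epsilon> > 0" and half: "half_approx_unconstrained (set us) f U"
  let ?A = "alg3 k \<epsilon> U"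
  define s where "s = state_after ?A f us (length us)"
  have inv: "stream_inv f k \<epsilon> (set us) s"
    using stream_inv_state_after[OF sub nn k eps dist order_refl] unfolding s_def by simp
  have final: "final_result ?A f us = run f (finish3 k \<epsilon> U s)"
    unfolding final_result_def arrivals_alg3 s_def by (simp add: alg3_def)
  have ret: "returned_set ?A f us = snd (run f (finish3 k \<epsilon> U s))"
    unfolding returned_set_def final ..
  have U: "run f (U (sets s 1 v)) \<subseteq> sets s 1 v" for v
    using half stream_inv_sets(1)[OF inv] unfolding half_approx_unconstrained_def by blast
  have cardU: "card (run f (U (sets s 1 v))) \<le> k" for v
    using card_mono[OF _ U, of v] stream_inv_sets(1,3)[OF inv, of v] finite_subset
    by (metis List.finite_set le_trans)
  have "returned_set ?A f us \<subseteq> set us \<and> card (returned_set ?A f us) \<le> k"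
  proof (cases "guesses k \<epsilon> (max_single s) = {}")
    case True
    then show ?thesis using run_finish3(2)[OF eps k, of s] unfolding ret by simp
  next
    case False
    then obtain v where
      "returned_set ?A f us \<in> {sets s 1 v, sets s 2 v, run f (U (sets s 1 v))}"
      using run_finish3(3)[OF eps k False, of f U] unfolding ret by blast
    then show ?thesis
      using stream_inv_sets[OF inv, of v] U[of v] cardU[of v] by auto
  qed
  then show sub_ret: "returned_set ?A f us \<subseteq> set us" and "card (returned_set ?A f us) \<le> k"
    by blast+
  obtain Y where Y: "Y \<subseteq> set us" "card Y \<le> k" "OPT (set us) f k = f Y"
    "\<And>Z. Z \<subseteq> set us \<Longrightarrow> card Z \<le> k \<Longrightarrow> f Z \<le> f Y"
    by (rule OPT_attained[OF List.finite_set, of us k f]) blast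
  show "(1/6 - \<epsilon>) * OPT (set us) f k \<le> f (returned_set ?A f us)"
    using finish3_approx[OF sub nn _ k eps half inv _ Y(1,2,4)] sub_ret unfolding ret Y(3) by simp
  show "passes ?A = 1" by (simp add: alg3_def)
  show "queries_per_element_at_most ?A f us (29 * (max 1 (log 2 (real k)) / min 1 \<epsilon>))"
    unfolding queries_per_element_at_most_def
    using num_queries_step3[OF eps k] by (auto simp: alg3_def)
  show "stores_at_most ?A f us (29 * (real k * max 1 (log 2 (real k)) / min 1 \<epsilon>))"
    unfolding stores_at_most_def memory_states_def arrivals_alg3
  proof (intro ballI, elim insertE imageE)
    \<comment> \<open>Only the state left by \<open>finish3\<close> has a populated third level; it
      is bounded through the first, as \<open>U\<close> returns a subset.\<close>
    fix t assume t: "t = fst (final_result ?A f us)"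
    have st: "sets t l v =
        (if l = 3 \<and> v \<in> guesses k \<epsilon> (max_single s) then run f (U (sets s 1 v)) else sets s l v)" for l v
      unfolding t final by (rule run_finish3(1)[OF eps k])
    have other: "sets s l v = {}" if "v \<notin> guesses k \<epsilon> (max_single s) \<or> l \<notin> {1, 2}" for l v
      using inv that unfolding stream_inv_def by blast
    have sub_t: "sets t l v \<subseteq> set us \<and> card (sets t l v) \<le> k" for l v
    proof (cases "l \<in> {1, 2, 3}")
      case True
      then show ?thesis
        using stream_inv_sets[OF inv, of v] U[of v] cardU[of v] other[of v l] st by auto
    qed (use st other in auto)
    show "finite (cells ?A t) \<and> real (card (cells ?A t)) + 1 \<le>
        29 * (real k * max 1 (log 2 (real k)) / min 1 \<epsilon>)"
    proof (rule cells_bound[OF eps k])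
      show "l \<in> {1, 2, 3} \<and> v \<in> guesses k \<epsilon> (max_single s)" if "sets t l v \<noteq> {}" for l v
        using that other[of v l] st[of l v] by (auto split: if_splits)
      show "finite (sets t l v)" "card (sets t l v) \<le> k" for l v
        using sub_t finite_subset by blast+
    qed
  next
    \<comment> \<open>During the stream the third level is empty, and the relevant window is that of
      the maximum seen so far.\<close>
    fix t j assume t: "t = state_after ?A f us j" and j: "j \<in> {..length us}"
    have invt: "stream_inv f k \<epsilon> (set (take j us)) t"
      unfolding t using j by (intro stream_inv_state_after[OF sub nn k eps dist]) simp
    have other: "sets t l v = {}" if "v \<notin> guesses k \<epsilon> (max_single t) \<or> l \<notin> {1, 2}" for l v
      using invt that unfolding stream_inv_def by blast
    have sub_t: "sets t l v \<subseteq> set us \<and> card (sets t l v) \<le> k" for l v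
      using stream_inv_sets[OF invt, of v] other[of v l] set_take_subset[of j us]
      by (cases "l \<in> {1, 2}") auto
    show "finite (cells ?A t) \<and> real (card (cells ?A t)) + 1 \<le>
        29 * (real k * max 1 (log 2 (real k)) / min 1 \<epsilon>)"
    proof (rule cells_bound[OF eps k])
      show "l \<in> {1, 2, 3} \<and> v \<in> guesses k \<epsilon> (max_single t)" if "sets t l v \<noteq> {}" for l v
        using that other[of v l] by auto
      show "finite (sets t l v)" "card (sets t l v) \<le> k" for l v
        using sub_t finite_subset by blast+
    qed
  qed
qed

end
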